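(* Let $n,k$ be positive integers, $m,p$ natural numbers, $Q_0,Q_i\in\mathcal S^n$ and $d_i\in\mathbb R$ for $i\in[m]$, and $a_i\in\mathbb R^n$, $b_i\in\mathbb R_+$ for $i\in[p]$. Consider the binary quadratic matrix program in the variable $P$ $$(QMP_1)\quad \min\;\operatorname{tr}(P^\top Q_0P)\quad\text{s.t.}\quad \operatorname{tr}(P^\top Q_iP)+d_i\le 0\ \ \forall i\in[m],\quad P^\top a_i\le b_i\mathbf 1_k\ \ \forall i\in[p],\quad P\mathbf 1_k\le\mathbf 1_n,\quad P\in\{0,1\}^{n\times k},$$ and the binary semidefinite program in the variables $X$, $x$ $$(BSDP_{QMP1})\quad \min\;\langle Q_0,X\rangle\quad\text{s.t.}\quad \langle Q_i,X\rangle+d_i\le 0\ \ \forall i\in[m],\quad Xa_i\le b_ix\ \ \forall i\in[p],$$ $$\begin{pmatrix}k&x^\top\\ x&X\end{pmatrix}\succeq\mathbf 0,\quad \operatorname{diag}(X)=x,\quad X\in\{0,1\}^{n\times n}.$$ Then $(BSDP_{QMP1})$ is equivalent to $(QMP_1)$.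
   Context: $[m]=\{1,\dots,m\}$; $\mathcal S^n$ is the set of real symmetric $n\times n$ matrices; $\mathbf 1_n$ is the all-ones vector in $\mathbb R^n$; $\langle X,Y\rangle=\operatorname{tr}(X^\top Y)$; $X\succeq\mathbf 0$ means $X$ is (symmetric) positive semidefinite; $\operatorname{diag}(X)$ is the vector of diagonal entries; vector inequalities are entrywise; $\mathbb R_+$ is the set of nonnegative reals. Two optimization problems are called equivalent if every feasible solution of either one yields a feasible solution of the other with the same objective value. *)

theory Defs
  imports "HOL-Analysis.Analysis"
begin

record 'a min_problem =
  feasible :: "'a set"
  objective :: "'a \<Rightarrow> real"

definition equivalent_problems :: "'a min_problem \<Rightarrow> 'b min_problem \<Rightarrow> bool" where
  "equivalent_problems A B \<longleftrightarrow>
     (\<forall>u\<in>feasible A. \<exists>v\<in>feasible B. objective B v = objective A u) \<and>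
     (\<forall>v\<in>feasible B. \<exists>u\<in>feasible A. objective A u = objective B v)"

definition symmetric_matrix :: "real^'n^'n \<Rightarrow> bool" where
  "symmetric_matrix A \<longleftrightarrow> transpose A = A"

definition psd :: "real^'n^'n \<Rightarrow> bool" where
  "psd A \<longleftrightarrow> symmetric_matrix A \<and> (\<forall>v. 0 \<le> v \<bullet> (A *v v))"

definition frob_inner :: "real^'n^'m \<Rightarrow> real^'n^'m \<Rightarrow> real" where
  "frob_inner X Y = trace (transpose X ** Y)"

definition diag_vec :: "real^'n^'n \<Rightarrow> real^'n" where
  "diag_vec X = (\<chi> i. X $ i $ i)"

definition binary_matrix :: "real^'n^'m \<Rightarrow> bool" where
  "binary_matrix X \<longleftrightarrow> (\<forall>i j. X $ i $ j \<in> {0, 1})"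

(* The block matrix with rows (c, x^T) and (x, X); None indexes the leading row and column. *)
definition bordered_matrix :: "real \<Rightarrow> real^'n \<Rightarrow> real^'n^'n \<Rightarrow> real^('n option)^('n option)" where
  "bordered_matrix c x X =
     (\<chi> i j. case i of
        None \<Rightarrow> (case j of None \<Rightarrow> c | Some j' \<Rightarrow> x $ j')
      | Some i' \<Rightarrow> (case j of None \<Rightarrow> x $ i' | Some j' \<Rightarrow> X $ i' $ j'))"

(* P : real^'k^'n is an n-by-k matrix, n = CARD('n) and k = CARD('k).
   Q 0 is the cost matrix. Values of Q outside {0..m}, of d outside {1..m}, and of
   a and b outside {1..p} are irrelevant. The order on vectors is entrywise. *)
definition QMP1 ::
  "nat \<Rightarrow> nat \<Rightarrow> (nat \<Rightarrow> real^'n^'n) \<Rightarrow> (nat \<Rightarrow> real) \<Rightarrow> (nat \<Rightarrow> real^'n) \<Rightarrow> (nat \<Rightarrow> real)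
     \<Rightarrow> (real^'k^'n) min_problem" where
  "QMP1 m p Q d a b =
     \<lparr> feasible = {P.
         (\<forall>i\<in>{1..m}. trace (transpose P ** Q i ** P) + d i \<le> 0) \<and>
         (\<forall>i\<in>{1..p}. transpose P *v a i \<le> b i *\<^sub>R vec 1) \<and>
         P *v vec 1 \<le> vec 1 \<and>
         binary_matrix P},
       objective = (\<lambda>P. trace (transpose P ** Q 0 ** P)) \<rparr>"

definition BSDP_QMP1 ::
  "nat \<Rightarrow> nat \<Rightarrow> nat \<Rightarrow> (nat \<Rightarrow> real^'n^'n) \<Rightarrow> (nat \<Rightarrow> real) \<Rightarrow> (nat \<Rightarrow> real^'n) \<Rightarrow> (nat \<Rightarrow> real)
     \<Rightarrow> ((real^'n^'n) \<times> (real^'n)) min_problem" where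
  "BSDP_QMP1 k m p Q d a b =
     \<lparr> feasible = {(X, x).
         (\<forall>i\<in>{1..m}. frob_inner (Q i) X + d i \<le> 0) \<and>
         (\<forall>i\<in>{1..p}. X *v a i \<le> b i *\<^sub>R x) \<and>
         psd (bordered_matrix (real k) x X) \<and>
         diag_vec X = x \<and>
         binary_matrix X},
       objective = (\<lambda>(X, x). frob_inner (Q 0) X) \<rparr>"

end

theory Submission
  imports Defs
begin

text \<open>
  The feasible matrices of the semidefinite program are exactly the Gram matrices
  \<open>P P\<^sup>T\<close> of binary \<open>P\<close> whose rows are unit vectors or zero.
  Testing semidefiniteness on \<open>e\<^sub>i - e\<^sub>j\<close> and \<open>e\<^sub>i - e\<^sub>j + e\<^sub>l\<close> shows that \<open>X\<^sub>i\<^sub>j = 1\<close> is a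
  partial equivalence relation; testing the bordered matrix on the vector with leading entry \<open>1\<close>
  and \<open>-1\<close> at one representative of each class shows that there are at most \<open>k\<close> classes, which
  can therefore be assigned to distinct columns of \<open>P\<close>.
\<close>

section \<open>Quadratic forms of bordered matrices\<close>

lemma bordered_quadratic_form:
  fixes v :: "real^('n::finite option)"
  defines "w \<equiv> \<chi> i. v $ Some i"
  shows "v \<bullet> (bordered_matrix c x X *v v)
     = c * (v $ None)\<^sup>2 + 2 * v $ None * (x \<bullet> w) + w \<bullet> (X *v w)"
proof -
  have sum_option: "(\<Sum>i\<in>UNIV. h i) = h None + (\<Sum>i\<in>UNIV. h (Some i))"
    for h :: "'n option \<Rightarrow> real"
    by (simp add: UNIV_option_conv sum.reindex)
  show ?thesis
    unfolding inner_vec_def matrix_vector_mult_def bordered_matrix_def w_def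
    by (simp add: sum_option algebra_simps sum.distrib sum_distrib_left power2_eq_square)
qed

lemma symmetric_bordered_matrix_iff:
  "symmetric_matrix (bordered_matrix c x X) \<longleftrightarrow> symmetric_matrix X"
  unfolding symmetric_matrix_def bordered_matrix_def transpose_def vec_eq_iff
  by (auto split: option.splits)

text \<open>A vector over the option type splits into its leading entry \<open>t\<close> and its
  remaining part \<open>w\<close>, which can be chosen independently. All later test vectors are
  given in this form.\<close>

lemma psd_bordered_matrix_iff:
  fixes x :: "real^'n" and X :: "real^'n^'n"
  shows
  "psd (bordered_matrix c x X) \<longleftrightarrow>
     symmetric_matrix X \<and> (\<forall>t w. 0 \<le> c * t\<^sup>2 + 2 * t * (x \<bullet> w) + w \<bullet> (X *v w))"
proof -
  have "(\<forall>v. 0 \<le> v \<bullet> (bordered_matrix c x X *v v)) \<longleftrightarrow>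
      (\<forall>t w. 0 \<le> c * t\<^sup>2 + 2 * t * (x \<bullet> w) + w \<bullet> (X *v w))" (is "?L \<longleftrightarrow> ?R")
  proof
    assume L: ?L
    show ?R
    proof (intro allI)
      fix t w
      define v :: "real^('n option)" where "v = (\<chi> i. case i of None \<Rightarrow> t | Some j \<Rightarrow> w $ j)"
      have "(\<chi> i. v $ Some i) = w" "v $ None = t"
        by (simp_all add: v_def vec_eq_iff)
      with L[rule_format, of v] show "0 \<le> c * t\<^sup>2 + 2 * t * (x \<bullet> w) + w \<bullet> (X *v w)"
        by (simp add: bordered_quadratic_form)
    qed
  qed (simp add: bordered_quadratic_form)
  then show ?thesis
    by (simp add: psd_def symmetric_bordered_matrix_iff)
qed

section \<open>Binary matrices with at most one 1 in each row\<close>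

definition partial_assignment :: "real^'k^'n \<Rightarrow> bool" where
  "partial_assignment P \<longleftrightarrow> (\<forall>i. P $ i = 0 \<or> (\<exists>c. P $ i = axis c 1))"

text \<open>All entries are nonnegative, so a second 1 in a row would push its sum above 1.\<close>

lemma partial_assignment_iff:
  "partial_assignment P \<longleftrightarrow> binary_matrix P \<and> P *v vec 1 \<le> vec 1"
proof
  assume "partial_assignment P"
  then have row: "P $ i = 0 \<or> (\<exists>c. P $ i = axis c 1)" for i
    by (simp add: partial_assignment_def)
  have "P $ i $ j \<in> {0, 1}" for i j
    using row[of i] by (auto simp: axis_def)
  moreover have "(P *v vec 1) $ i \<le> 1" for i
    using row[of i] by (auto simp: matrix_vector_mul_component inner_axis')
  ultimately show "binary_matrix P \<and> P *v vec 1 \<le> vec 1"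
    by (simp add: binary_matrix_def less_eq_vec_def)
next
  assume asm: "binary_matrix P \<and> P *v vec 1 \<le> vec 1"
  then have bin: "P $ i $ c = 0 \<or> P $ i $ c = 1" for i c
    by (auto simp: binary_matrix_def)
  have row_sum: "(\<Sum>c\<in>UNIV. P $ i $ c) \<le> 1" for i
    using asm by (auto simp: less_eq_vec_def matrix_vector_mult_def)
  have "P $ i = axis c 1" if c: "P $ i $ c = 1" for i c
  proof -
    have nonneg: "0 \<le> P $ i $ c'" for c'
      using bin[of i c'] by auto
    have "P $ i $ c' = 0" if "c' \<noteq> c" for c'
    proof -
      have "P $ i $ c + P $ i $ c' = (\<Sum>e\<in>{c, c'}. P $ i $ e)"
        using that by simp
      also have "\<dots> \<le> (\<Sum>e\<in>UNIV. P $ i $ e)"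
        by (rule sum_mono2) (use nonneg in auto)
      finally show ?thesis
        using row_sum[of i] c nonneg[of c'] by linarith
    qed
    with c show ?thesis
      by (simp add: vec_eq_iff axis_def)
  qed
  then show "partial_assignment P"
    unfolding partial_assignment_def using bin by (metis vec_eq_iff zero_index)
qed

section \<open>Gram matrices of partial assignments\<close>

lemma gram_component: "(P ** transpose P) $ i $ j = P $ i \<bullet> P $ j"
  for P :: "real^'k^'n"
  by (simp add: matrix_matrix_mult_def transpose_def inner_vec_def)

lemma symmetric_gram: "symmetric_matrix (P ** transpose P)"
  by (simp add: symmetric_matrix_def matrix_transpose_mul)

text \<open>For a zero or unit row, the squared norm equals the entry sum. The constraint
  \<open>diag_vec X = x\<close> therefore determines which \<open>x\<close> accompanies the Gram
  matrix.\<close>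

lemma diag_gram:
  assumes "partial_assignment P"
  shows "diag_vec (P ** transpose P) = P *v vec 1"
proof -
  have "P $ i \<bullet> P $ i = P $ i \<bullet> vec 1" for i
    using assms[unfolded partial_assignment_def, rule_format, of i]
    by (auto simp: inner_axis')
  then show ?thesis
    by (simp add: vec_eq_iff diag_vec_def gram_component matrix_vector_mul_component)
qed

lemma binary_gram:
  assumes "partial_assignment P"
  shows "binary_matrix (P ** transpose P)"
  unfolding binary_matrix_def
proof (intro allI)
  fix i j
  show "(P ** transpose P) $ i $ j \<in> {0, 1}"
    using assms[unfolded partial_assignment_def, rule_format, of i]
      assms[unfolded partial_assignment_def, rule_format, of j]
    by (auto simp: gram_component inner_axis_axis)
qed

text \<open>The bordered matrix is itself a Gram matrix: that of the all-ones vector, whose squared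
  norm is \<open>CARD('k)\<close>, followed by the rows of \<open>P\<close>. Its form at
  \<open>(t, w)\<close> is the squared norm of \<open>vec t + transpose P *v w\<close>.\<close>

lemma psd_bordered_gram:
  fixes P :: "real^'k^'n"
  shows "psd (bordered_matrix (real CARD('k)) (P *v vec 1) (P ** transpose P))"
  unfolding psd_bordered_matrix_iff
proof (intro conjI allI symmetric_gram)
  fix t w
  let ?u = "transpose P *v w"
  have "0 \<le> (vec t + ?u) \<bullet> (vec t + ?u)"
    by simp
  also have "\<dots> = vec t \<bullet> (vec t :: real^'k) + 2 * (vec t \<bullet> ?u) + ?u \<bullet> ?u"
    by (simp add: inner_add_left inner_add_right inner_commute)
  also have "vec t \<bullet> (vec t :: real^'k) = real CARD('k) * t\<^sup>2"
    by (simp add: inner_vec_def power2_eq_square)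
  also have "vec t \<bullet> ?u = t * ((P *v vec 1) \<bullet> w)"
  proof -
    have "vec t = t *\<^sub>R (vec 1 :: real^'k)"
      by (simp add: vec_eq_iff)
    moreover have "vec 1 \<bullet> ?u = (P *v vec 1) \<bullet> w"
      by (metis dot_lmul_matrix inner_commute transpose_matrix_vector)
    ultimately show ?thesis
      by (metis inner_scaleR_left)
  qed
  also have "?u \<bullet> ?u = w \<bullet> ((P ** transpose P) *v w)"
    by (metis dot_lmul_matrix matrix_vector_mul_assoc transpose_matrix_vector)
  finally show "0 \<le> real CARD('k) * t\<^sup>2 + 2 * t * ((P *v vec 1) \<bullet> w)
      + w \<bullet> ((P ** transpose P) *v w)"
    by (simp add: algebra_simps)
qed

text \<open>The trace is invariant under cyclic shifts; symmetry of \<open>A\<close> removes the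
  transpose in \<open>frob_inner\<close>.\<close>

lemma frob_inner_gram:
  fixes P :: "real^'k^'n"
  assumes "symmetric_matrix A"
  shows "frob_inner A (P ** transpose P) = trace (transpose P ** A ** P)"
proof -
  have "trace (A ** P ** transpose P) = trace (transpose P ** (A ** P))"
    unfolding trace_def matrix_matrix_mult_def
    by (simp add: mult.commute) (rule sum.swap)
  then show ?thesis
    using assms by (simp add: frob_inner_def symmetric_matrix_def matrix_mul_assoc)
qed

lemma gram_linear_constraint_iff:
  fixes P :: "real^'k^'n"
  assumes P: "partial_assignment P" and "0 \<le> \<beta>"
  shows "(P ** transpose P) *v \<alpha> \<le> \<beta> *\<^sub>R (P *v vec 1) \<longleftrightarrow> transpose P *v \<alpha> \<le> \<beta> *\<^sub>R vec 1"
proof -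
  let ?y = "transpose P *v \<alpha>"
  have row: "P $ i = 0 \<or> (\<exists>c. P $ i = axis c 1)" for i
    using P by (simp add: partial_assignment_def)
  have iff: "(P ** transpose P) *v \<alpha> \<le> \<beta> *\<^sub>R (P *v vec 1) \<longleftrightarrow>
      (\<forall>i. P $ i \<bullet> ?y \<le> \<beta> * (P $ i \<bullet> vec 1))"
    by (simp add: less_eq_vec_def matrix_vector_mul_component flip: matrix_vector_mul_assoc)
  show ?thesis
  proof
    assume L: "(P ** transpose P) *v \<alpha> \<le> \<beta> *\<^sub>R (P *v vec 1)"
    have "?y $ c \<le> \<beta>" for c
    proof (cases "\<exists>i. P $ i = axis c 1")
      case True
      then obtain i where "P $ i = axis c 1" ..
      with L show ?thesis
        unfolding iff by (auto simp: inner_axis' dest: spec[of _ i])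
    next
      case False
      then have "P $ i $ c = 0" for i
        using row[of i] by (auto simp: axis_def)
      then have "?y $ c = 0"
        by (simp add: matrix_vector_mult_def transpose_def)
      with \<open>0 \<le> \<beta>\<close> show ?thesis
        by simp
    qed
    then show "?y \<le> \<beta> *\<^sub>R vec 1"
      by (simp add: less_eq_vec_def)
  next
    assume R: "?y \<le> \<beta> *\<^sub>R vec 1"
    show "(P ** transpose P) *v \<alpha> \<le> \<beta> *\<^sub>R (P *v vec 1)"
      unfolding iff
    proof
      fix i
      show "P $ i \<bullet> ?y \<le> \<beta> * (P $ i \<bullet> vec 1)"
        using row[of i] R by (auto simp: inner_axis' less_eq_vec_def)
    qed
  qed
qed

section \<open>Factoring a feasible binary matrix\<close>

lemma axis_quadratic: "axis i 1 \<bullet> (X *v axis j 1) = X $ i $ j"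
  for X :: "real^'n^'m"
  by (simp add: inner_axis' matrix_vector_mul_component inner_axis)

lemma binary_psd_eq_gram:
  fixes X :: "real^'n^'n"
  assumes psd: "psd (bordered_matrix (real CARD('k::finite)) (diag_vec X) X)"
    and bin: "binary_matrix X"
  obtains P :: "real^'k^'n" where "partial_assignment P" "X = P ** transpose P"
proof -
  have sym_X: "symmetric_matrix X"
    and form: "0 \<le> real CARD('k) * t\<^sup>2 + 2 * t * (diag_vec X \<bullet> w) + w \<bullet> (X *v w)" for t w
    using psd by (auto simp: psd_bordered_matrix_iff)
  have sym: "X $ i $ j = X $ j $ i" for i j
    using sym_X by (simp add: symmetric_matrix_def transpose_def vec_eq_iff)
  have form0: "0 \<le> w \<bullet> (X *v w)" for w
    using form[of 0 w] by simp
  have bin01: "X $ i $ j = 0 \<or> X $ i $ j = 1" for i j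
    using bin by (auto simp: binary_matrix_def)
  \<comment> \<open>The form at \<open>axis i 1 - axis j 1\<close> is
    \<open>X $ i $ i + X $ j $ j - 2\<close>, so both diagonal entries must be 1.\<close>
  have diag: "X $ i $ i = 1" if "X $ i $ j = 1" for i j
    using form0[of "axis i 1 - axis j 1"] that sym[of i j] bin01[of i i] bin01[of j j]
    by (auto simp: matrix_vector_mult_diff_distrib inner_diff_left inner_diff_right axis_quadratic)
  have trans: "X $ i $ l = 1" if "X $ i $ j = 1" "X $ j $ l = 1" for i j l
  proof -
    have "X $ i $ i = 1" "X $ j $ j = 1" "X $ l $ l = 1"
      using that diag sym by metis+
    \<comment> \<open>The form at this vector is \<open>3 - 4 + 2 * X $ i $ l\<close>, which is
      negative if \<open>X $ i $ l = 0\<close>.\<close>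
    then show ?thesis
      using form0[of "axis i 1 - axis j 1 + axis l 1"] that
        sym[of i j] sym[of j l] sym[of i l] bin01[of i l]
      by (auto simp: matrix_vector_mult_diff_distrib matrix_vector_right_distrib inner_add_left
          inner_add_right inner_diff_left inner_diff_right axis_quadratic)
  qed
  define S where "S = {i. X $ i $ i = 1}"
  define C where "C i = {j. X $ i $ j = 1}" for i
  \<comment> \<open>The restriction to \<open>S\<close> matters: by \<open>diag\<close>, all indices
    outside \<open>S\<close> share the empty class although they are unrelated.\<close>
  have C_eq_iff: "C i = C j \<longleftrightarrow> X $ i $ j = 1" if "i \<in> S" "j \<in> S" for i j
    using that trans sym unfolding C_def S_def by (smt (verit) Collect_cong mem_Collect_eq)
  obtain R where "R \<subseteq> S" and inj: "inj_on C R" and CR: "C ` S = C ` R"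
    using subset_image_inj[of "C ` S" C S] by auto
  \<comment> \<open>\<open>R\<close> holds one representative per class, so \<open>X\<close>
    restricted to \<open>R\<close> is the identity, and both the quadratic and the linear term at
    the indicator \<open>w\<close> count the classes.\<close>
  define w where "w = (\<Sum>i\<in>R. axis i (1::real))"
  have off_diag: "X $ i $ j = (if i = j then 1 else 0)" if "i \<in> R" "j \<in> R" for i j
    using that \<open>R \<subseteq> S\<close> inj C_eq_iff[of i j] bin01[of i j] unfolding S_def inj_on_def by auto
  have "w \<bullet> (X *v w) = (\<Sum>i\<in>R. \<Sum>j\<in>R. X $ i $ j)"
    unfolding w_def
    by (simp add: linear_sum[OF matrix_vector_mul_linear] inner_sum_left inner_sum_right axis_quadratic)
      (rule sum.swap)
  also have "\<dots> = (\<Sum>i\<in>R. \<Sum>j\<in>R. if i = j then 1 else 0)"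
    by (intro sum.cong refl) (simp add: off_diag)
  finally have "w \<bullet> (X *v w) = card R"
    by simp
  moreover have "diag_vec X \<bullet> w = card R"
  proof -
    have "diag_vec X \<bullet> w = (\<Sum>i\<in>R. X $ i $ i)"
      unfolding w_def by (simp add: inner_sum_right inner_axis diag_vec_def)
    then show ?thesis
      by (simp add: off_diag)
  qed
  \<comment> \<open>At leading entry 1 and remaining part \<open>- w\<close> the form is
    \<open>CARD('k) - 2 * card R + card R\<close>.\<close>
  ultimately have "card R \<le> CARD('k)"
    using form[of 1 "- w"] by (simp add: linear_neg[OF matrix_vector_mul_linear])
  then have "card (C ` S) \<le> CARD('k)"
    by (simp add: CR card_image[OF inj])
  then obtain f :: "'n set \<Rightarrow> 'k" where f: "inj_on f (C ` S)"
    using inj_on_iff_card_le[of "C ` S" "UNIV :: 'k set"] by auto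
  \<comment> \<open>Each class owns its own column, so two rows indexed by \<open>S\<close> have
    inner product 1 within a class and 0 across classes.\<close>
  define P :: "real^'k^'n" where "P = (\<chi> i. if i \<in> S then axis (f (C i)) 1 else 0)"
  have "partial_assignment P"
    by (auto simp: partial_assignment_def P_def)
  moreover have "X $ i $ j = P $ i \<bullet> P $ j" for i j
  proof (cases "i \<in> S \<and> j \<in> S")
    case True
    then have "f (C i) = f (C j) \<longleftrightarrow> X $ i $ j = 1"
      using f C_eq_iff[of i j] by (auto simp: inj_on_def)
    then show ?thesis
      using True bin01[of i j] by (auto simp: P_def inner_axis_axis)
  next
    case False
    \<comment> \<open>An entry 1 would put both \<open>i\<close> and \<open>j\<close> into
      \<open>S\<close>, by \<open>diag\<close> and symmetry.\<close>
    then have "X $ i $ j = 0"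
      using bin01[of i j] diag[of i j] diag[of j i] sym[of i j] by (auto simp: S_def)
    with False show ?thesis
      by (auto simp: P_def)
  qed
  then have "X = P ** transpose P"
    by (simp add: vec_eq_iff gram_component)
  ultimately show thesis ..
qed

theorem theorem10:
  fixes m p :: nat
    and Q :: "nat \<Rightarrow> real^'n^'n"
    and d :: "nat \<Rightarrow> real"
    and a :: "nat \<Rightarrow> real^'n"
    and b :: "nat \<Rightarrow> real"
  assumes "\<And>i. i \<in> {0..m} \<Longrightarrow> symmetric_matrix (Q i)"
    and "\<And>i. i \<in> {1..p} \<Longrightarrow> 0 \<le> b i"
  shows "equivalent_problems
           (BSDP_QMP1 CARD('k::finite) m p Q d a b)
           (QMP1 m p Q d a b :: (real^'k^'n) min_problem)"
proof -
  let ?B = "BSDP_QMP1 CARD('k) m p Q d a b"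
  let ?A = "QMP1 m p Q d a b :: (real^'k^'n) min_problem"
  let ?lift = "\<lambda>P::real^'k^'n. (P ** transpose P, P *v vec 1)"
  have obj: "objective ?B (?lift P) = objective ?A P" for P
    using assms(1)[of 0] by (simp add: BSDP_QMP1_def QMP1_def frob_inner_gram)
  \<comment> \<open>On partial assignments the lift preserves feasibility in both directions. It
    remains to see that every feasible \<open>P\<close> is a partial assignment and every feasible
    pair is a lift of one.\<close>
  have feas: "?lift P \<in> feasible ?B \<longleftrightarrow> P \<in> feasible ?A" if "partial_assignment P" for P
    using that assms partial_assignment_iff[of P]
    by (auto simp: BSDP_QMP1_def QMP1_def frob_inner_gram gram_linear_constraint_iff
        psd_bordered_gram diag_gram binary_gram
        simp del: transpose_matrix_vector vec_1)
  have "partial_assignment P" if "P \<in> feasible ?A" for P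
    using that by (simp add: QMP1_def partial_assignment_iff)
  moreover have "\<exists>P. partial_assignment P \<and> v = ?lift P" if v: "v \<in> feasible ?B" for v
  proof -
    obtain X x where Xx: "v = (X, x)"
      by (cases v)
    then have "psd (bordered_matrix (real CARD('k)) (diag_vec X) X)" "binary_matrix X"
      and x: "x = diag_vec X"
      using v by (auto simp: BSDP_QMP1_def)
    then obtain P :: "real^'k^'n" where P: "partial_assignment P" "X = P ** transpose P"
      using binary_psd_eq_gram by blast
    then show ?thesis
      using Xx x diag_gram by blast
  qed
  ultimately show ?thesis
    unfolding equivalent_problems_def by (metis feas obj)
qed

end
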